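(* Let $d\ge2$, $\ell\in\mathbb{R}^d\setminus\{0\}$, and for $e\in\nu$ let $J^e=G^{\omega_0}(0,0)-G^{\omega_0}(e,0)$. Then the first-order coefficient $v_\ell'(1)$ can be written as \[ v_{\ell}'(1)=\sum_{e\in \nu} (v_{\ell}(1)\cdot e)\, \frac{p(e) J^e}{1-p(e)J^e-p(-e)J^{-e}}\,(e-v_{\ell}(1)). \] Consequently, if for every $e\in \nu$ such that $v_{\ell}(1) \cdot e >0$ we have $v_{\ell}(1) \cdot e \geq \|v_{\ell}(1)\|_2^2$, then \[ v_{\ell}(1)\cdot v_{\ell}'(1)>0 . \] The condition that $v_\ell(1)\cdot e\ge\|v_\ell(1)\|_2^2$ for every $e\in\nu$ with $v_\ell(1)\cdot e>0$ is satisfied in each of the following cases: (1) $\vec \ell \in \nu$; (2) $\ell = \lambda \vec \ell$ with $0<\lambda<\lambda_c(\vec \ell)$, for some $\lambda_c(\vec \ell)>0$ depending on the direction $\vec\ell$.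
   Context: $\nu$ is the set of the $2d$ unit vectors of $\mathbb{Z}^d$; $\ell=\lambda\vec\ell$ with $\lambda>0$ and $\vec\ell$ of Euclidean norm $1$. A configuration is $\omega\in\{0,1\}^{E(\mathbb{Z}^d)}$ ($E(\mathbb Z^d)$ the nearest-neighbour edges); an edge $f$ is open if $\omega(f)=1$, closed otherwise. Put $c^\omega(x,y)=e^{(x+y)\cdot\ell}$ if $x,y$ are adjacent in $\mathbb{Z}^d$ and $[x,y]$ is open, and $0$ otherwise. Under $P_x^\omega$, $(X_n)$ is the Markov chain started at $x$ with transition probabilities $p^\omega(x,y)=c^\omega(x,y)/\sum_zc^\omega(x,z)$ (and $p^\omega(x,x)=1$ if $x$ has no open adjacent edge). $G^\omega(x,y)=E_x^\omega[\sum_{n\ge0}\mathbf 1\{X_n=y\}]$. $\omega_0$ is the configuration with all edges open, and $p(e)=p^{\omega_0}(0,e)$. For $e\in\nu$, $\omega_0^e$ is the configuration whose only closed edge is $[0,e]$, and $d_e=\sum_{e'\in\nu}p^{\omega_0^e}(0,e')e'$. For $p\in(p_c(d),1)$ ($p_c(d)$ the critical probability of Bernoulli bond percolation on $\mathbb{Z}^d$), $v_\ell(p)$ denotes the deterministic a.s. limit of $X_n/n$ for the walk started at $0$ in Bernoulli($p$) bond percolation conditioned on $0$ belonging to the unique infinite cluster, and $v_\ell(1)=\sum_{e\in\nu}p(e)e$. The vector $v_\ell'(1)$ is the coefficient in the first-order expansion $v_\ell(1-\varepsilon)=v_\ell(1)-\varepsilon v_\ell'(1)+o(\varepsilon)$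 as $\varepsilon\to0^+$, namely \[ v_\ell'(1)=\sum_{e\in \nu} (v_{\ell}(1)\cdot e)\bigl(G^{\omega^{e}_0}(0,0)-G^{\omega^{e}_0}(e,0)\bigr)(v_{\ell}(1)-d_e). \] *)

theory Defs
  imports "HOL-Probability.Probability"
begin

section \<open>The law of a discrete Markov chain on path space\<close>

text \<open>
  The law of the trajectory \<open>(X\<^sub>n)\<close> of the Markov chain with transition kernel \<open>K\<close> started at \<open>x\<close>
  is the Ionescu-Tulcea limit of the kernels below: given the history \<open>h\<close> up to time \<open>n - 1\<close>,
  the state at time \<open>n\<close> is \<open>x\<close> for \<open>n = 0\<close> and has law \<open>K (h (n - 1))\<close> otherwise.
\<close>

definition chain_kernel :: "('s \<Rightarrow> 's pmf) \<Rightarrow> 's \<Rightarrow> nat \<Rightarrow> (nat \<Rightarrow> 's) \<Rightarrow> 's measure" where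
  "chain_kernel K x n h = measure_pmf (if n = 0 then return_pmf x else K (h (n - 1)))"

definition chain_law :: "('s \<Rightarrow> 's pmf) \<Rightarrow> 's \<Rightarrow> (nat \<Rightarrow> 's) measure" where
  "chain_law K x =
     projective_family.lim UNIV (Ionescu_Tulcea.CI (chain_kernel K x) (\<lambda>_. count_space UNIV))
       (\<lambda>_. count_space UNIV)"

lemma Ionescu_Tulcea_chain_kernel:
  "Ionescu_Tulcea (chain_kernel K x) (\<lambda>_. count_space UNIV)"
proof (rule Ionescu_Tulcea.intro)
  fix n :: nat
  show "chain_kernel K x n
      \<in> measurable (PiM {0..<n} (\<lambda>_. count_space UNIV)) (subprob_algebra (count_space UNIV))"
  proof (cases n)
    case 0
    have "chain_kernel K x n = (\<lambda>h. measure_pmf (return_pmf x))"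
      using 0 by (simp add: chain_kernel_def fun_eq_iff)
    then show ?thesis
      by (simp add: space_subprob_algebra measure_pmf.subprob_space_axioms)
  next
    case (Suc m)
    have K: "(\<lambda>s. measure_pmf (K s))
        \<in> measurable (count_space UNIV) (subprob_algebra (count_space UNIV))"
      by (simp add: space_subprob_algebra measure_pmf.subprob_space_axioms)
    have "(\<lambda>h. h m) \<in> measurable (PiM {0..<n} (\<lambda>_. count_space UNIV)) (count_space UNIV)"
      using Suc by (intro measurable_component_singleton) auto
    from measurable_compose[OF this K] show ?thesis
      using Suc by (simp add: chain_kernel_def[abs_def])
  qed
qed (simp add: chain_kernel_def measure_pmf.prob_space_axioms)

section \<open>Biased random walk on a configuration of open edges\<close>

text \<open>
  \<open>\<int>\<^sup>d\<close> is \<open>int ^ 'n\<close> with \<open>d = CARD('n)\<close>; \<open>emb\<close> is the inclusion \<open>\<int>\<^sup>d \<rightarrow> \<real>\<^sup>d\<close>.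
\<close>

definition emb :: "int ^ 'n \<Rightarrow> real ^ 'n" where
  "emb x = (\<chi> i. of_int (x $ i))"

definition unit_vecs :: "(int ^ 'n) set" where
  "unit_vecs = {axis i s | i s. s = 1 \<or> s = -1}"

text \<open>
  A configuration assigns to the edge \<open>[x, y]\<close>, encoded as the set \<open>{x, y}\<close>, the value
  \<open>True\<close> if it is open and \<open>False\<close> if it is closed. Its values on sets that are not
  nearest-neighbour edges play no role.
\<close>

type_synonym 'n config = "(int ^ 'n) set \<Rightarrow> bool"

definition all_open :: "'n config" where
  "all_open f \<longleftrightarrow> True"

definition one_closed :: "int ^ 'n \<Rightarrow> 'n config" where
  "one_closed e f \<longleftrightarrow> f \<noteq> {0, e}"

definition conductance :: "real ^ 'n \<Rightarrow> 'n config \<Rightarrow> int ^ 'n \<Rightarrow> int ^ 'n \<Rightarrow> real" where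
  "conductance l \<omega> x y = (if y - x \<in> unit_vecs \<and> \<omega> {x, y} then exp (emb (x + y) \<bullet> l) else 0)"

definition trans_prob :: "real ^ 'n \<Rightarrow> 'n config \<Rightarrow> int ^ 'n \<Rightarrow> int ^ 'n \<Rightarrow> real" where
  "trans_prob l \<omega> x y =
     (if \<exists>e\<in>unit_vecs. \<omega> {x, x + e}
      then conductance l \<omega> x y / (\<Sum>e\<in>unit_vecs. conductance l \<omega> x (x + e))
      else if y = x then 1 else 0)"

definition walk_step :: "real ^ 'n \<Rightarrow> 'n config \<Rightarrow> int ^ 'n \<Rightarrow> (int ^ 'n) pmf" where
  "walk_step l \<omega> x = embed_pmf (trans_prob l \<omega> x)"

lemma finite_unit_vecs [simp]: "finite (unit_vecs :: (int ^ 'n) set)"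
proof -
  have "unit_vecs \<subseteq> range (\<lambda>i. axis i 1 :: int ^ 'n) \<union> range (\<lambda>i. axis i (-1))"
    by (auto simp: unit_vecs_def)
  then show ?thesis
    by (rule finite_subset) simp
qed

lemma pmf_walk_step: "pmf (walk_step l \<omega> x) y = trans_prob l \<omega> x y"
  unfolding walk_step_def
proof (rule pmf_embed_pmf)
  have c: "conductance l \<omega> x z \<ge> 0" for z
    by (simp add: conductance_def)
  show nonneg: "0 \<le> trans_prob l \<omega> x z" for z
    by (auto simp: trans_prob_def c intro!: divide_nonneg_nonneg sum_nonneg)
  show "(\<integral>\<^sup>+z. ennreal (trans_prob l \<omega> x z) \<partial>count_space UNIV) = 1"
  proof (cases "\<exists>e\<in>unit_vecs. \<omega> {x, x + e}")
    case True
    define S where "S = (\<Sum>e\<in>unit_vecs. conductance l \<omega> x (x + e))"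
    from True obtain e where e: "e \<in> unit_vecs" "\<omega> {x, x + e}"
      by blast
    have "S > 0"
      unfolding S_def
      by (rule sum_pos2[OF finite_unit_vecs e(1)]) (use e c in \<open>simp_all add: conductance_def\<close>)
    have "trans_prob l \<omega> x z = 0" if "z \<notin> (+) x ` unit_vecs" for z
    proof -
      have "z = x + (z - x)"
        by simp
      then have "z - x \<notin> unit_vecs"
        using that by blast
      then show ?thesis
        using True by (simp add: trans_prob_def conductance_def)
    qed
    then have "(\<integral>\<^sup>+z. ennreal (trans_prob l \<omega> x z) \<partial>count_space UNIV)
        = (\<Sum>z\<in>(+) x ` unit_vecs. ennreal (trans_prob l \<omega> x z))"
      by (intro nn_integral_count_space') auto
    also have "\<dots> = ennreal (\<Sum>z\<in>(+) x ` unit_vecs. trans_prob l \<omega> x z)"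
      by (simp add: nonneg sum_ennreal)
    also have "(\<Sum>z\<in>(+) x ` unit_vecs. trans_prob l \<omega> x z) = S / S"
      using True by (simp add: sum.reindex trans_prob_def S_def flip: sum_divide_distrib)
    finally show ?thesis
      using \<open>S > 0\<close> by simp
  next
    case False
    then have "(\<integral>\<^sup>+z. ennreal (trans_prob l \<omega> x z) \<partial>count_space UNIV)
        = (\<Sum>z\<in>{x}. ennreal (trans_prob l \<omega> x z))"
      by (intro nn_integral_count_space') (auto simp: trans_prob_def)
    then show ?thesis
      using False by (simp add: trans_prob_def)
  qed
qed

text \<open>Expected number of visits to \<open>y\<close> of the walk started at \<open>x\<close>.\<close>

definition green :: "real ^ 'n \<Rightarrow> 'n config \<Rightarrow> int ^ 'n \<Rightarrow> int ^ 'n \<Rightarrow> ennreal" where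
  "green l \<omega> x y = (\<integral>\<^sup>+X. (\<Sum>n. indicator {y} (X n)) \<partial>chain_law (walk_step l \<omega>) x)"

section \<open>Speed at \<open>p = 1\<close> and its first-order coefficient\<close>

definition p0 :: "real ^ 'n \<Rightarrow> int ^ 'n \<Rightarrow> real" where
  "p0 l e = trans_prob l all_open 0 e"

definition v1 :: "real ^ 'n \<Rightarrow> real ^ 'n" where
  "v1 l = (\<Sum>e\<in>unit_vecs. p0 l e *\<^sub>R emb e)"

definition drift :: "real ^ 'n \<Rightarrow> int ^ 'n \<Rightarrow> real ^ 'n" where
  "drift l e = (\<Sum>e'\<in>unit_vecs. trans_prob l (one_closed e) 0 e' *\<^sub>R emb e')"

text \<open>
  The vector \<open>v'\<^sub>\<ell>(1)\<close> of the expansion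
  \<open>v\<^sub>\<ell>(1 - \<epsilon>) = v\<^sub>\<ell>(1) - \<epsilon> v'\<^sub>\<ell>(1) + o(\<epsilon>)\<close> of the speed on Bernoulli percolation clusters,
  given by its explicit expression in terms of Green functions. For \<open>\<ell> \<noteq> 0\<close> the walks involved are transient,
  so no value of \<open>green\<close> that occurs is infinite.
\<close>

definition v1' :: "real ^ 'n \<Rightarrow> real ^ 'n" where
  "v1' l = (\<Sum>e\<in>unit_vecs.
     ((v1 l \<bullet> emb e) *
       (enn2real (green l (one_closed e) 0 0) - enn2real (green l (one_closed e) e 0)))
     *\<^sub>R (v1 l - drift l e))"

definition green_gap :: "real ^ 'n \<Rightarrow> int ^ 'n \<Rightarrow> real" where
  "green_gap l e = enn2real (green l all_open 0 0) - enn2real (green l all_open e 0)"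

definition speed_condition :: "real ^ 'n \<Rightarrow> bool" where
  "speed_condition l \<longleftrightarrow>
     (\<forall>e\<in>unit_vecs. v1 l \<bullet> emb e > 0 \<longrightarrow> v1 l \<bullet> emb e \<ge> (norm (v1 l))\<^sup>2)"

end

theory Submission
  imports Defs
begin

text \<open>
  Write \<open>p = p0 l\<close>, let \<open>P\<close> and \<open>P\<^sup>e\<close> be the one-step averages of the walk in the open configuration and in
  the configuration where only \<open>[0, e]\<close> is closed, \<open>G\<close> the Green function of the open configuration
  with target \<open>0\<close>, and \<open>J\<^sup>e = G(0) - G(e)\<close>. A Green function is the least nonnegative
  \<open>f\<close> with \<open>\<delta>\<^sub>0 + P f \<le> f\<close>, so bounds for it can be read off from explicit
  superharmonic functions.

  The function \<open>h(x) = exp (-x \<bullet> l)\<close> satisfies \<open>P h = \<rho> h\<close> with \<open>\<rho> < 1\<close> because \<open>l \<noteq> 0\<close>. This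
  makes \<open>G\<close> finite, and comparing \<open>G\<close> with the minimum of itself and a multiple of a
  superharmonic function gives \<open>G \<le> G(0)\<close> and \<open>G \<le> G(0) h\<close>. If \<open>G(e) = G(0)\<close>, this
  maximum would propagate along paths that avoid \<open>0\<close>, and in dimension at least two such a path
  reaches a point with \<open>h < 1\<close>, which is impossible. Hence \<open>J\<^sup>e > 0\<close> (\<open>green_gap_pos\<close>). The equation
  \<open>G = \<delta>\<^sub>0 + P G\<close> at \<open>0\<close> says \<open>\<Sum>\<^sub>e p(e) J\<^sup>e = 1\<close>, and since there are directions other than
  \<open>\<plusminus>e\<close>, the denominator \<open>1 - p(e) J\<^sup>e - p(-e) J\<^bsup>-e\<^esup>\<close> is positive (\<open>escape_pos\<close>).

  Closing \<open>[0, e]\<close> changes \<open>P\<close> at \<open>0\<close> and \<open>e\<close> only. So for \<open>f(x) = a G(x) + b G(x - e)\<close> the function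
  \<open>f - P\<^sup>e f\<close> is supported on \<open>{0, e}\<close>, with values that depend on \<open>a\<close>, \<open>b\<close> and \<open>f(0) - f(e)\<close>
  (\<open>walk_mean_green_combination\<close>). The choice \<open>a = J\<^bsup>-e\<^esup>\<close>, \<open>b = J\<^sup>e\<close> makes \<open>f(0) = f(e)\<close> and both values
  positive, which proves that the Green function with \<open>[0, e]\<close> closed is finite. Another choice makes
  \<open>f - P\<^sup>e f = \<delta>\<^sub>0\<close>; then \<open>f\<close> is that Green function, because the difference of the two is
  harmonic and bounded by a multiple of \<open>h\<close>, whose potential \<open>\<Sum>\<^sub>n (P\<^sup>e)\<^sup>n h\<close> is finite. Reading
  off \<open>f(0) - f(e)\<close> gives \<open>green_one_closed_gap\<close>, and with it the formula for \<open>v1'\<close>.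

  In \<open>v1 \<bullet> v1'\<close> the direction \<open>e\<close> contributes a positive multiple of
  \<open>(v1 \<bullet> e) (v1 \<bullet> e - \<bar>v1\<bar>\<^sup>2)\<close>. This is nonnegative when \<open>v1 \<bullet> e > 0\<close> by the speed condition and
  positive when \<open>v1 \<bullet> e < 0\<close>, and the latter occurs since \<open>v1 \<bullet> e = p(e) - p(-e)\<close> has the sign of
  \<open>e \<bullet> l\<close>. Finally, for \<open>l\<close> along an axis \<open>v1 \<bullet> e\<close> is positive for one \<open>e\<close> only and the condition
  follows by averaging; for small bias \<open>v1 \<bullet> e\<close> is of first order and \<open>\<bar>v1\<bar>\<^sup>2\<close> of
  second order in \<open>\<lambda>\<close>.
\<close>

section \<open>Green functions as potentials\<close>

definition kernel_op :: "('s \<Rightarrow> 's pmf) \<Rightarrow> ('s \<Rightarrow> ennreal) \<Rightarrow> 's \<Rightarrow> ennreal" where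
  "kernel_op K f x = (\<integral>\<^sup>+y. f y \<partial>measure_pmf (K x))"

text \<open>
  The sum of the iterates takes values in the extended nonnegative reals, so that it exists before
  anything is known about transience.
\<close>

definition potential :: "('s \<Rightarrow> 's pmf) \<Rightarrow> ('s \<Rightarrow> ennreal) \<Rightarrow> 's \<Rightarrow> ennreal" where
  "potential K s x = (\<Sum>n. (kernel_op K ^^ n) s x)"

lemma sets_chain_law [measurable_cong]:
  "sets (chain_law K x) = sets (PiM UNIV (\<lambda>_. count_space UNIV))"
proof -
  interpret IT: Ionescu_Tulcea "chain_kernel K x" "\<lambda>_. count_space UNIV"
    by (rule Ionescu_Tulcea_chain_kernel)
  show ?thesis
    unfolding chain_law_def by (rule IT.PF.sets_lim)
qed

text \<open>
  By the consistency of the Ionescu-Tulcea kernels, the law of \<open>X\<^sub>n\<close> is the last coordinate of the \<open>n\<close>-th finite stage,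
  and integrating that coordinate out replaces \<open>f\<close> by its average after one step.
\<close>

lemma nn_integral_chain_law:
  fixes f :: "'s \<Rightarrow> ennreal"
  shows "(\<integral>\<^sup>+X. f (X n) \<partial>chain_law K x) = (kernel_op K ^^ n) f x"
proof -
  interpret IT: Ionescu_Tulcea "chain_kernel K x" "\<lambda>_. count_space UNIV"
    by (rule Ionescu_Tulcea_chain_kernel)
  let ?M = "\<lambda>_::nat. count_space (UNIV::'s set)"
  let ?u = "\<lambda>_::nat. undefined::'s"
  have u: "?u \<in> space (PiM {0..<0} ?M)"
    by (simp add: space_PiM)
  have coord: "(\<lambda>h. f' (h i)) \<in> borel_measurable (PiM I ?M)" if "i \<in> I" for i I and f' :: "'s \<Rightarrow> ennreal"
    using measurable_compose[OF measurable_component_singleton[OF that], of f' ?M borel] by simp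
  (* The coordinate n is already determined by the first n + 1 kernels. *)
  have marginal: "(\<integral>\<^sup>+X. f (X n) \<partial>chain_law K x) = (\<integral>\<^sup>+h. f (h n) \<partial>IT.C 0 (Suc n) ?u)"
  proof -
    have up: "IT.up_to {n} = Suc n"
      by (rule antisym) (auto simp: IT.up_to_iff Suc_le_eq intro: IT.up_to_less)
    have "(\<integral>\<^sup>+X. f (X n) \<partial>chain_law K x)
        = (\<integral>\<^sup>+h. f (h n) \<partial>distr (chain_law K x) (PiM {n} ?M) (\<lambda>X. restrict X {n}))"
      by (subst nn_integral_distr)
         (auto intro!: coord measurable_restrict measurable_component_singleton
               simp: measurable_cong_sets[OF sets_chain_law refl])
    also have "distr (chain_law K x) (PiM {n} ?M) (\<lambda>X. restrict X {n}) = IT.CI {n}"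
      unfolding chain_law_def by (rule IT.distr_lim) simp
    also have "(\<integral>\<^sup>+h. f (h n) \<partial>IT.CI {n}) = (\<integral>\<^sup>+h. f (h n) \<partial>IT.C 0 (Suc n) ?u)"
      unfolding IT.CI_def up
      by (subst nn_integral_distr)
         (auto intro!: coord measurable_restrict measurable_component_singleton
               simp: measurable_cong_sets[OF IT.sets_C[OF u] refl] simp del: IT.C.simps)
    finally show ?thesis .
  qed
  have step: "(\<integral>\<^sup>+h. f' (h m) \<partial>IT.C 0 (Suc m) ?u)
      = (\<integral>\<^sup>+h. (\<integral>\<^sup>+y. f' y \<partial>chain_kernel K x m h) \<partial>IT.C 0 m ?u)" for m and f' :: "'s \<Rightarrow> ennreal"
  proof -
    have "(\<integral>\<^sup>+h. f' (h m) \<partial>IT.C 0 (Suc m) ?u)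
        = (\<integral>\<^sup>+h. (\<integral>\<^sup>+h'. f' (h' m) \<partial>IT.eP m h) \<partial>IT.C 0 m ?u)"
      using IT.measurable_eP[of m] 
      by (simp add: nn_integral_bind[where B="PiM {0..<Suc m} ?M"] coord
            measurable_cong_sets[OF IT.sets_C[OF u] refl])
    also have "\<dots> = (\<integral>\<^sup>+h. (\<integral>\<^sup>+y. f' y \<partial>chain_kernel K x m h) \<partial>IT.C 0 m ?u)"
      by (intro nn_integral_cong) (simp add: IT.space_C[OF u] IT.nn_integral_eP coord)
    finally show ?thesis .
  qed
  have "(\<integral>\<^sup>+h. f' (h m) \<partial>IT.C 0 (Suc m) ?u) = (kernel_op K ^^ m) f' x" for m and f' :: "'s \<Rightarrow> ennreal"
  proof (induction m arbitrary: f')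
    case 0
    have "(\<integral>\<^sup>+h. f' (h 0) \<partial>IT.C 0 (Suc 0) ?u) = (\<integral>\<^sup>+h. f' x \<partial>IT.C 0 0 ?u)"
      unfolding step by (simp add: chain_kernel_def)
    also have "\<dots> = f' x"
      using prob_space.emeasure_space_1[OF IT.prob_space_C[OF u, of 0]] by simp
    finally show ?case by simp
  next
    case (Suc m)
    have "(\<integral>\<^sup>+h. f' (h (Suc m)) \<partial>IT.C 0 (Suc (Suc m)) ?u)
        = (\<integral>\<^sup>+h. kernel_op K f' (h m) \<partial>IT.C 0 (Suc m) ?u)"
      unfolding step[of "Suc m" f'] by (simp add: chain_kernel_def kernel_op_def del: IT.C.simps)
    also have "\<dots> = (kernel_op K ^^ m) (kernel_op K f') x"
      by (rule Suc.IH)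
    finally show ?case
      by (simp add: funpow_swap1)
  qed
  with marginal show ?thesis
    by simp
qed

lemma green_eq_potential: "green l \<omega> x y = potential (walk_step l \<omega>) (indicator {y}) x"
proof -
  have [measurable]: "(\<lambda>X. indicator {y} (X n) :: ennreal) \<in> borel_measurable (chain_law (walk_step l \<omega>) x)" for n
    using measurable_compose[OF measurable_component_singleton[of n UNIV "\<lambda>_. count_space UNIV"],
        of "indicator {y} :: _ \<Rightarrow> ennreal" borel]
    by (simp add: measurable_cong_sets[OF sets_chain_law refl])
  show ?thesis
    unfolding green_def potential_def
    by (subst nn_integral_suminf) (simp_all add: nn_integral_chain_law)
qed

lemma kernel_op_mono: "(\<And>x. f x \<le> g x) \<Longrightarrow> kernel_op K f x \<le> kernel_op K g x"
  unfolding kernel_op_def by (intro nn_integral_mono) auto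

lemma kernel_op_suminf: "kernel_op K (\<lambda>x. \<Sum>n. f n x) x = (\<Sum>n. kernel_op K (f n) x)"
  unfolding kernel_op_def by (intro nn_integral_suminf) auto

lemma potential_unfold: "potential K s x = s x + kernel_op K (potential K s) x"
proof -
  have "kernel_op K (potential K s) x = (\<Sum>n. (kernel_op K ^^ Suc n) s x)"
    by (simp add: potential_def[abs_def] kernel_op_suminf)
  moreover have "(\<Sum>n. (kernel_op K ^^ n) s x) = (kernel_op K ^^ 0) s x + (\<Sum>n. (kernel_op K ^^ Suc n) s x)"
    using suminf_offset[OF summableI, of "\<lambda>n. (kernel_op K ^^ n) s x" 1] by (simp add: add.commute)
  ultimately show ?thesis
    by (simp add: potential_def)
qed

text \<open>
  The partial sums satisfy \<open>S\<^sub>n\<^sub>+\<^sub>1 = s + K S\<^sub>n\<close>, so every solution of the inequality dominates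
  all of them by induction.
\<close>

lemma potential_least:
  assumes "\<And>x. s x + kernel_op K f x \<le> f x"
  shows "potential K s x \<le> f x"
proof -
  have "(\<Sum>i<n. (kernel_op K ^^ i) s x) \<le> f x" for n x
  proof (induction n arbitrary: x)
    case (Suc n)
    have "(\<Sum>i<Suc n. (kernel_op K ^^ i) s x) = s x + kernel_op K (\<lambda>x. \<Sum>i<n. (kernel_op K ^^ i) s x) x"
      unfolding sum.lessThan_Suc_shift by (simp add: kernel_op_def nn_integral_sum)
    also have "\<dots> \<le> s x + kernel_op K f x"
      by (intro add_left_mono kernel_op_mono Suc.IH)
    also have "\<dots> \<le> f x"
      by (rule assms)
    finally show ?case .
  qed simp
  then show ?thesis
    unfolding potential_def by (intro suminf_le_const summableI)
qed

text \<open>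
  A subharmonic \<open>s\<close> is below each of its iterates, so its potential is a series whose terms are
  all at least \<open>s x\<close>. This is what replaces a convergence argument in the uniqueness proof below.
\<close>

lemma subharmonic_finite_potential_zero:
  assumes sub: "\<And>x. s x \<le> kernel_op K s x" and fin: "potential K s x < \<infinity>"
  shows "s x = 0"
proof (rule ccontr)
  assume "s x \<noteq> 0"
  have "s y \<le> (kernel_op K ^^ n) s y" for n y
  proof (induction n arbitrary: y)
    case (Suc n)
    have "s y \<le> kernel_op K s y" by (rule sub)
    also have "\<dots> \<le> kernel_op K ((kernel_op K ^^ n) s) y"
      by (rule kernel_op_mono) (rule Suc.IH)
    finally show ?case by simp
  qed simp
  then have "(\<Sum>n::nat. s x) \<le> potential K s x"
    unfolding potential_def by (intro suminf_le summableI)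
  moreover have "(\<Sum>n::nat. s x) = \<infinity>"
    using nn_integral_count_space_nat[of "\<lambda>_. s x"] \<open>s x \<noteq> 0\<close>
    by (simp add: nn_integral_const ennreal_mult_top)
  ultimately show False
    using fin by simp
qed

section \<open>Unit vectors\<close>

lemma emb_simps [simp]:
  "emb (x + y) = emb x + emb y" "emb (- x) = - emb x" "emb 0 = 0" "emb (x - y) = emb x - emb y"
  "emb (2 * x) = 2 *\<^sub>R emb x"
  by (simp_all add: emb_def vec_eq_iff)

lemma emb_axis [simp]: "emb (axis i s) = axis i (of_int s)"
  by (simp add: emb_def axis_def vec_eq_iff)

lemma unit_vecs_iff: "e \<in> unit_vecs \<longleftrightarrow> (\<exists>i. e = axis i 1 \<or> e = axis i (-1))"
  by (auto simp: unit_vecs_def)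

lemma uminus_axis: "- axis i a = axis i (- a :: 'a::group_add)"
  by (simp add: axis_def vec_eq_iff)

lemma uminus_unit_vecs [simp]: "- e \<in> unit_vecs \<longleftrightarrow> e \<in> unit_vecs"
proof -
  have "- e \<in> unit_vecs" if "e \<in> unit_vecs" for e :: "int ^ 'n"
    using that by (auto simp: unit_vecs_iff uminus_axis)
  from this[of e] this[of "- e"] show ?thesis
    by auto
qed

lemma unit_vec_nonzero: "e \<in> unit_vecs \<Longrightarrow> e \<noteq> 0"
  by (auto simp: unit_vecs_iff axis_eq_0_iff)

lemma double_eq_0_iff [simp]: "2 * e = 0 \<longleftrightarrow> e = 0" for e :: "int ^ 'n"
  by (simp add: vec_eq_iff)

lemma unit_vec_neq_uminus: "e \<in> unit_vecs \<Longrightarrow> - e \<noteq> e"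
proof
  assume "e \<in> unit_vecs" "- e = e"
  from this(2) have "e = 0"
    by (simp add: vec_eq_iff)
  with unit_vec_nonzero[OF \<open>e \<in> unit_vecs\<close>] show False
    by contradiction
qed

lemma sum_unit_vecs_uminus: "(\<Sum>e\<in>unit_vecs. f (- e)) = (\<Sum>e\<in>unit_vecs. f e)"
  by (rule sum.reindex_bij_witness[of _ uminus uminus]) auto

lemma unit_vec_direction:
  fixes l :: "real ^ 'n"
  assumes "l \<noteq> 0"
  obtains f where "f \<in> unit_vecs" "emb f \<bullet> l > 0"
proof -
  from assms obtain i where i: "l $ i \<noteq> 0"
    by (auto simp: vec_eq_iff)
  show thesis
  proof (cases "l $ i > 0")
    case True
    then show ?thesis
      by (intro that[of "axis i 1"]) (auto simp: unit_vecs_iff inner_axis')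
  next
    case False
    with i show ?thesis
      by (intro that[of "axis i (-1)"]) (auto simp: unit_vecs_iff inner_axis')
  qed
qed

text \<open>
  The place where the dimension matters: there is room to step sideways. In dimension one the walk
  started upstream of \<open>0\<close> has to pass through \<open>0\<close>, and the strict inequalities below
  fail.
\<close>

lemma ex_other_unit_vec:
  fixes l :: "real ^ 'n" and e :: "int ^ 'n"
  assumes "CARD('n) \<ge> 2" "e \<in> unit_vecs"
  obtains f where "f \<in> unit_vecs" "f \<noteq> e" "f \<noteq> - e" "emb f \<bullet> l \<ge> 0"
proof -
  from assms(2) obtain i where i: "e = axis i 1 \<or> e = axis i (-1)"
    by (auto simp: unit_vecs_iff)
  have "\<exists>j. j \<noteq> i"
  proof (rule ccontr)
    assume "\<nexists>j. j \<noteq> i"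
    then have "UNIV = {i}"
      by auto
    then have "CARD('n) = 1"
      by (metis card_1_singleton_iff One_nat_def)
    with assms(1) show False
      by simp
  qed
  then obtain j where j: "j \<noteq> i" ..
  define f :: "int ^ 'n" where "f = (if l $ j \<ge> 0 then axis j 1 else axis j (-1))"
  show thesis
  proof (rule that[of f])
    show "f \<in> unit_vecs"
      by (auto simp: f_def unit_vecs_iff)
    show "f \<noteq> e" "f \<noteq> - e"
      using i j by (auto simp: f_def axis_eq_axis uminus_axis)
    show "emb f \<bullet> l \<ge> 0"
      by (simp add: f_def inner_axis')
  qed
qed

section \<open>One step of the walk\<close>

definition partition_sum :: "real ^ 'n::finite \<Rightarrow> real" where
  "partition_sum l = (\<Sum>e\<in>unit_vecs. exp (emb e \<bullet> l))"

lemma partition_sum_pos: "partition_sum l > 0"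
  unfolding partition_sum_def
proof (rule sum_pos)
  show "unit_vecs \<noteq> {}"
    by (auto simp: unit_vecs_def)
qed simp_all

text \<open>
  This excludes the holding clause of \<open>trans_prob\<close>: the walk then moves to a neighbour in
  every step.
\<close>

definition no_isolated :: "('n::finite) config \<Rightarrow> bool" where
  "no_isolated \<omega> \<longleftrightarrow> (\<forall>x. \<exists>e\<in>unit_vecs. \<omega> {x, x + e})"

lemma no_isolated_all_open [simp]: "no_isolated all_open"
  by (auto simp: no_isolated_def all_open_def unit_vecs_def)

lemma edge_eq_iff:
  fixes x e f :: "int ^ 'n"
  assumes "e \<in> unit_vecs"
  shows "{x, x + f} = {0, e} \<longleftrightarrow> x = 0 \<and> f = e \<or> x = e \<and> f = - e"
  using unit_vec_nonzero[OF assms] by (auto simp: doubleton_eq_iff add_eq_0_iff)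

lemma no_isolated_one_closed [simp]:
  assumes "(e :: int ^ 'n) \<in> unit_vecs"
  shows "no_isolated (one_closed e)"
  unfolding no_isolated_def
proof
  fix x :: "int ^ 'n"
  show "\<exists>f\<in>unit_vecs. one_closed e {x, x + f}"
    using assms unit_vec_neq_uminus[OF assms]
    by (intro bexI[of _ "if x = 0 then - e else e"]) (auto simp: one_closed_def edge_eq_iff doubleton_eq_iff)
qed

text \<open>
  The conductances from \<open>x\<close> have the common factor \<open>exp (2 x \<bullet> l)\<close>, which cancels. This is why the open
  walk is translation invariant although its conductances are not.
\<close>

lemma trans_prob_no_isolated:
  assumes "no_isolated \<omega>" "f \<in> unit_vecs"
  shows "trans_prob l \<omega> x (x + f)
    = (if \<omega> {x, x + f} then exp (emb f \<bullet> l) else 0)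
      / (\<Sum>f'\<in>unit_vecs. if \<omega> {x, x + f'} then exp (emb f' \<bullet> l) else 0)"
proof -
  have c: "conductance l \<omega> x (x + f') = exp (2 * (emb x \<bullet> l)) * (if \<omega> {x, x + f'} then exp (emb f' \<bullet> l) else 0)"
    if "f' \<in> unit_vecs" for f'
    using that by (simp add: conductance_def inner_add_left exp_add[symmetric])
  show ?thesis
    using assms by (simp add: trans_prob_def no_isolated_def c sum_distrib_left[symmetric])
qed

lemma trans_prob_all_open:
  assumes "f \<in> unit_vecs"
  shows "trans_prob l all_open x (x + f) = exp (emb f \<bullet> l) / partition_sum l"
  using assms by (simp add: trans_prob_no_isolated partition_sum_def) (simp add: all_open_def)

lemma p0_eq: "e \<in> unit_vecs \<Longrightarrow> p0 l e = exp (emb e \<bullet> l) / partition_sum l"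
  using trans_prob_all_open[of e l 0] by (simp add: p0_def)

lemma p0_pos: "e \<in> unit_vecs \<Longrightarrow> p0 l e > 0"
  by (simp add: p0_eq partition_sum_pos)

lemma sum_p0: "(\<Sum>e\<in>unit_vecs. p0 l e) = 1"
  using partition_sum_pos[of l]
  by (simp add: p0_eq sum_divide_distrib[symmetric] partition_sum_def[symmetric])

lemma p0_less_1:
  assumes "e \<in> unit_vecs"
  shows "p0 l e < 1"
proof -
  have "sum (p0 l) {e, - e} \<le> (\<Sum>e\<in>unit_vecs. p0 l e)"
    using assms by (intro sum_mono2) (auto intro: less_imp_le p0_pos)
  then show ?thesis
    using assms unit_vec_neq_uminus[OF assms] p0_pos[of "- e" l] by (simp add: sum_p0)
qed

definition walk_mean :: "real ^ 'n \<Rightarrow> 'n config \<Rightarrow> (int ^ 'n \<Rightarrow> real) \<Rightarrow> int ^ 'n \<Rightarrow> real" where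
  "walk_mean l \<omega> f x = (\<Sum>e\<in>unit_vecs. trans_prob l \<omega> x (x + e) * f (x + e))"

lemma trans_prob_nonneg: "trans_prob l \<omega> x y \<ge> 0"
  by (metis pmf_nonneg pmf_walk_step)

lemma walk_mean_add: "walk_mean l \<omega> (\<lambda>x. f x + g x) x = walk_mean l \<omega> f x + walk_mean l \<omega> g x"
  by (simp add: walk_mean_def distrib_left sum.distrib)

lemma walk_mean_diff: "walk_mean l \<omega> (\<lambda>x. f x - g x) x = walk_mean l \<omega> f x - walk_mean l \<omega> g x"
  by (simp add: walk_mean_def right_diff_distrib sum_subtractf)

lemma walk_mean_cmult: "walk_mean l \<omega> (\<lambda>x. c * f x) x = c * walk_mean l \<omega> f x"
  by (simp add: walk_mean_def sum_distrib_left mult.left_commute)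

lemma walk_mean_mono:
  "(\<And>x. f x \<le> g x) \<Longrightarrow> walk_mean l \<omega> f x \<le> walk_mean l \<omega> g x"
  unfolding walk_mean_def by (intro sum_mono mult_left_mono trans_prob_nonneg)

lemma walk_mean_nonneg: "(\<And>x. f x \<ge> 0) \<Longrightarrow> walk_mean l \<omega> f x \<ge> 0"
  unfolding walk_mean_def by (intro sum_nonneg mult_nonneg_nonneg trans_prob_nonneg)

lemma walk_mean_all_open: "walk_mean l all_open f x = (\<Sum>e\<in>unit_vecs. p0 l e * f (x + e))"
  by (simp add: walk_mean_def trans_prob_all_open p0_eq)

lemma kernel_op_walk_step:
  assumes "no_isolated \<omega>" "\<And>x. f x \<ge> 0"
  shows "kernel_op (walk_step l \<omega>) (\<lambda>y. ennreal (f y)) x = ennreal (walk_mean l \<omega> f x)"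
proof -
  have zero: "trans_prob l \<omega> x z = 0" if "z \<notin> (+) x ` unit_vecs" for z
  proof -
    have "z = x + (z - x)"
      by simp
    then have "z - x \<notin> unit_vecs"
      using that by blast
    then show ?thesis
      using assms(1) by (simp add: trans_prob_def conductance_def no_isolated_def)
  qed
  have "kernel_op (walk_step l \<omega>) (\<lambda>y. ennreal (f y)) x
      = (\<integral>\<^sup>+z. ennreal (trans_prob l \<omega> x z) * ennreal (f z) \<partial>count_space UNIV)"
    by (simp add: kernel_op_def nn_integral_measure_pmf pmf_walk_step)
  also have "\<dots> = (\<Sum>z\<in>(+) x ` unit_vecs. ennreal (trans_prob l \<omega> x z) * ennreal (f z))"
    by (intro nn_integral_count_space') (auto simp: zero)
  also have "\<dots> = (\<Sum>e\<in>unit_vecs. ennreal (trans_prob l \<omega> x (x + e) * f (x + e)))"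
    by (simp add: sum.reindex ennreal_mult trans_prob_nonneg assms)
  also have "\<dots> = ennreal (walk_mean l \<omega> f x)"
    unfolding walk_mean_def by (intro sum_ennreal mult_nonneg_nonneg trans_prob_nonneg assms)
  finally show ?thesis .
qed

lemma trans_prob_one_closed:
  assumes e: "e \<in> unit_vecs" and f: "f \<in> unit_vecs"
  shows "trans_prob l (one_closed e) x (x + f) =
    (if x = 0 then (if f = e then 0 else p0 l f / (1 - p0 l e))
     else if x = e then (if f = - e then 0 else p0 l f / (1 - p0 l (- e)))
     else p0 l f)"
proof -
  have rescale: "exp (emb f \<bullet> l) / (partition_sum l - exp (emb g \<bullet> l)) = p0 l f / (1 - p0 l g)"
    if "g \<in> unit_vecs" for g
  proof -
    have "1 - p0 l g = (partition_sum l - exp (emb g \<bullet> l)) / partition_sum l"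
      using partition_sum_pos[of l] that by (simp add: p0_eq diff_divide_distrib)
    then show ?thesis
      using partition_sum_pos[of l] f by (simp add: p0_eq)
  qed
  have remove: "(\<Sum>f'\<in>unit_vecs. if f' \<noteq> g then exp (emb f' \<bullet> l) else 0) = partition_sum l - exp (emb g \<bullet> l)"
    if "g \<in> unit_vecs" for g
  proof -
    have "(\<Sum>f'\<in>unit_vecs. if f' \<noteq> g then exp (emb f' \<bullet> l) else 0)
        = (\<Sum>f'\<in>unit_vecs - {g}. exp (emb f' \<bullet> l))"
      by (rule sum.mono_neutral_cong_right) auto
    with that show ?thesis
      by (simp add: partition_sum_def sum_diff1)
  qed
  consider "x = 0" | "x = e" "x \<noteq> 0" | "x \<noteq> 0" "x \<noteq> e" by blast
  then show ?thesis
  proof cases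
    case 1
    then show ?thesis
      unfolding trans_prob_no_isolated[OF no_isolated_one_closed[OF e] f]
      using e f unit_vec_nonzero[OF e]
      by (simp add: one_closed_def edge_eq_iff[OF e, of 0, simplified] remove rescale)
  next
    case 2
    then show ?thesis
      using e f edge_eq_iff[OF e, of e] rescale[of "- e"]
      by (simp add: trans_prob_no_isolated one_closed_def remove rescale)
  next
    case 3
    then show ?thesis
      using e f
      by (simp add: trans_prob_no_isolated one_closed_def edge_eq_iff[OF e] partition_sum_def[symmetric] p0_eq)
  qed
qed

text \<open>
  At the two ends of the closed edge the mean drops the forbidden neighbour and renormalises.
\<close>

lemma walk_mean_one_closed:
  assumes e: "e \<in> unit_vecs"
  shows "walk_mean l (one_closed e) f x =
    (if x = 0 then (walk_mean l all_open f 0 - p0 l e * f e) / (1 - p0 l e)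
     else if x = e then (walk_mean l all_open f e - p0 l (- e) * f 0) / (1 - p0 l (- e))
     else walk_mean l all_open f x)"
proof -
  have remove: "(\<Sum>f'\<in>unit_vecs. (if f' = g then 0 else p0 l f' / c) * f (x + f'))
      = (walk_mean l all_open f x - p0 l g * f (x + g)) / c" if "g \<in> unit_vecs" for g c
  proof -
    have "(\<Sum>f'\<in>unit_vecs. (if f' = g then 0 else p0 l f' / c) * f (x + f'))
        = (\<Sum>f'\<in>unit_vecs - {g}. p0 l f' / c * f (x + f'))"
      using that by (simp add: sum.remove[of _ g])
    also have "\<dots> = (\<Sum>f'\<in>unit_vecs - {g}. p0 l f' * f (x + f')) / c"
      by (simp add: sum_divide_distrib)
    finally show ?thesis
      using that by (simp add: walk_mean_all_open sum.remove[of _ g])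
  qed
  consider "x = 0" | "x = e" "x \<noteq> 0" | "x \<noteq> 0" "x \<noteq> e" by blast
  then show ?thesis
  proof cases
    case 1
    then show ?thesis
      using remove[of e "1 - p0 l e"] e trans_prob_one_closed[OF e, of _ l 0]
      by (simp add: walk_mean_def[of l "one_closed e"])
  next
    case 2
    then show ?thesis
      using remove[of "- e" "1 - p0 l (- e)"] e trans_prob_one_closed[OF e, of _ l e]
      by (simp add: walk_mean_def[of l "one_closed e"])
  next
    case 3
    then show ?thesis
      using e by (simp add: walk_mean_def[of l "one_closed e"] walk_mean_all_open trans_prob_one_closed)
  qed
qed

section \<open>Superharmonic bounds for Green functions\<close>

text \<open>
  Transience is proved with this lemma: exhibiting a real-valued \<open>f\<close> bounds the Green function and
  in particular makes it finite.
\<close>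

lemma green_le:
  assumes \<omega>: "no_isolated \<omega>" and f: "\<And>x. f x \<ge> 0"
    and super: "\<And>x. of_bool (x = y) + walk_mean l \<omega> f x \<le> f x"
  shows "green l \<omega> x y \<le> ennreal (f x)"
  unfolding green_eq_potential
proof (rule potential_least)
  fix x
  have "indicator {y} x = ennreal (of_bool (x = y))"
    by (simp add: indicator_def)
  then show "indicator {y} x + kernel_op (walk_step l \<omega>) (\<lambda>x. ennreal (f x)) x \<le> ennreal (f x)"
    using super[of x] walk_mean_nonneg[of f l \<omega> x, OF f]
    by (simp add: kernel_op_walk_step[OF \<omega> f] ennreal_leI flip: ennreal_plus)
qed

lemma green_unfold:
  assumes \<omega>: "no_isolated \<omega>" and fin: "\<And>x. green l \<omega> x y < \<infinity>"
  defines "G \<equiv> \<lambda>x. enn2real (green l \<omega> x y)"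
  shows "G x = of_bool (x = y) + walk_mean l \<omega> G x"
proof -
  have "potential (walk_step l \<omega>) (indicator {y}) = (\<lambda>x. ennreal (G x))"
    using fin by (auto simp: G_def fun_eq_iff green_eq_potential)
  from potential_unfold[of "walk_step l \<omega>" "indicator {y}" x, unfolded this]
  have "ennreal (G x) = indicator {y} x + ennreal (walk_mean l \<omega> G x)"
    by (subst (asm) kernel_op_walk_step[OF \<omega>]) (simp_all add: G_def)
  also have "indicator {y} x = ennreal (of_bool (x = y))"
    by (simp add: indicator_def)
  finally show ?thesis
    using walk_mean_nonneg[of G l \<omega> x] by (simp add: G_def flip: ennreal_plus)
qed

text \<open>
  The uniqueness principle that identifies Green functions. The function \<open>W\<close> bounds the potential
  of \<open>\<bar>u\<bar>\<close>, and \<open>\<bar>u\<bar>\<close> is subharmonic by the triangle inequality.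
\<close>

lemma harmonic_zero:
  assumes \<omega>: "no_isolated \<omega>" and harm: "\<And>x. walk_mean l \<omega> u x = u x"
    and W: "\<And>x. W x \<ge> 0" "\<And>x. \<bar>u x\<bar> + walk_mean l \<omega> W x \<le> W x"
  shows "u x = 0"
proof -
  let ?K = "walk_step l \<omega>" and ?s = "\<lambda>x. ennreal \<bar>u x\<bar>"
  have "?s x = 0"
  proof (rule subharmonic_finite_potential_zero[of ?s ?K])
    fix x
    have "\<bar>u x\<bar> \<le> walk_mean l \<omega> (\<lambda>x. \<bar>u x\<bar>) x"
    proof -
      have "\<bar>u x\<bar> = \<bar>\<Sum>e\<in>unit_vecs. trans_prob l \<omega> x (x + e) * u (x + e)\<bar>"
        using harm[of x] by (simp add: walk_mean_def)
      also have "\<dots> \<le> (\<Sum>e\<in>unit_vecs. \<bar>trans_prob l \<omega> x (x + e) * u (x + e)\<bar>)"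
        by (rule sum_abs)
      finally show ?thesis
        by (simp add: walk_mean_def abs_mult trans_prob_nonneg)
    qed
    then show "?s x \<le> kernel_op ?K ?s x"
      by (subst kernel_op_walk_step[OF \<omega>]) (simp_all add: ennreal_leI)
  next
    have "potential ?K ?s x \<le> ennreal (W x)"
    proof (rule potential_least)
      fix x
      show "?s x + kernel_op ?K (\<lambda>x. ennreal (W x)) x \<le> ennreal (W x)"
        using W(2)[of x] walk_mean_nonneg[of W l \<omega> x, OF W(1)]
        by (simp add: kernel_op_walk_step[OF \<omega> W(1)] ennreal_leI flip: ennreal_plus)
    qed
    then show "potential ?K ?s x < \<infinity>"
      by (rule le_less_trans) simp
  qed
  then show ?thesis
    by simp
qed

section \<open>An exponential function contracted by the walk\<close>

text \<open>
  Under the weight \<open>exp (-x \<bullet> l)\<close> the jump probabilities \<open>exp (e \<bullet> l) / Z\<close> become equal, that is, the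
  biased walk turns into \<open>\<rho>\<close> times the simple random walk, where \<open>\<rho>\<close> is \<open>decay l\<close> below.
\<close>

definition tilt :: "real ^ 'n \<Rightarrow> int ^ 'n \<Rightarrow> real" where
  "tilt l x = exp (- (emb x \<bullet> l))"

lemma tilt_pos: "tilt l x > 0"
  by (simp add: tilt_def)

lemma tilt_add: "tilt l (x + y) = tilt l x * tilt l y"
  by (simp add: tilt_def inner_add_left exp_add[symmetric])

lemma tilt_0 [simp]: "tilt l 0 = 1"
  by (simp add: tilt_def)

definition decay :: "real ^ 'n::finite \<Rightarrow> real" where
  "decay l = card (unit_vecs :: (int ^ 'n) set) / partition_sum l"

lemma walk_mean_tilt: "walk_mean l all_open (tilt l) x = decay l * tilt l x"
proof -
  have "p0 l e * tilt l (x + e) = tilt l x / partition_sum l" if "e \<in> unit_vecs" for e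
  proof -
    have "exp (emb e \<bullet> l) * tilt l (x + e) = tilt l x"
      by (simp add: tilt_def inner_add_left exp_add[symmetric])
    then show ?thesis
      using that by (simp add: p0_eq)
  qed
  then show ?thesis
    by (simp add: walk_mean_all_open decay_def)
qed

lemma sum_unit_vecs_inner: "(\<Sum>e\<in>unit_vecs. emb e \<bullet> l) = 0"
  using sum_unit_vecs_uminus[of "\<lambda>e. emb e \<bullet> l"] by (simp add: sum_negf)

text \<open>
  Strict convexity: \<open>exp a \<ge> 1 + a\<close> with strict inequality for \<open>a > 0\<close>, and the linear
  terms cancel in the sum over \<open>\<plusminus>e\<close>.
\<close>

lemma decay_less_1:
  fixes l :: "real ^ 'n"
  assumes "l \<noteq> 0"
  shows "decay l < 1"
proof -
  obtain f where f: "f \<in> unit_vecs" "emb f \<bullet> l > 0"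
    using unit_vec_direction[OF assms] .
  have strict: "1 + a < exp a" if "a > 0" for a :: real
  proof -
    have "1 + a < (1 + a / 2)\<^sup>2"
      using that by (simp add: power2_eq_square algebra_simps)
    also have "\<dots> \<le> (exp (a / 2))\<^sup>2"
      using that exp_ge_add_one_self[of "a / 2"] by (intro power_mono) auto
    also have "\<dots> = exp a"
      by (simp add: exp_double[symmetric])
    finally show ?thesis .
  qed
  have "(\<Sum>e\<in>unit_vecs. 1 + emb e \<bullet> l) < partition_sum l"
    unfolding partition_sum_def
    by (rule sum_strict_mono_ex1) (use f strict exp_ge_add_one_self in auto)
  then have "card (unit_vecs :: (int ^ 'n) set) < partition_sum l"
    by (simp add: sum.distrib sum_unit_vecs_inner)
  then show ?thesis
    using partition_sum_pos[of l] by (simp add: decay_def)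
qed

lemma decay_nonneg: "decay l \<ge> 0"
  using partition_sum_pos[of l] by (simp add: decay_def)

section \<open>The Green function when all edges are open\<close>

locale biased_walk =
  fixes l :: "real ^ 'n"
  assumes bias: "l \<noteq> 0" and dim: "CARD('n) \<ge> 2"
begin

definition green0 :: "int ^ 'n \<Rightarrow> real" where
  "green0 x = enn2real (green l all_open x 0)"

text \<open>
  The geometric series \<open>\<Sum>\<^sub>n \<rho>\<^sup>n h = h / (1 - \<rho>)\<close> of the eigenfunction \<open>h = tilt l\<close> dominates the visits to
  \<open>0\<close>, as \<open>h(0) = 1\<close>.
\<close>

lemma green_all_open_finite: "green l all_open x 0 < \<infinity>"
proof -
  have d: "1 - decay l > 0"
    using decay_less_1[OF bias] by simp
  have "green l all_open x 0 \<le> ennreal (1 / (1 - decay l) * tilt l x)"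
  proof (rule green_le[OF no_isolated_all_open])
    show "0 \<le> 1 / (1 - decay l) * tilt l y" for y
      using d tilt_pos[of l y] by simp
    show "of_bool (y = 0) + walk_mean l all_open (\<lambda>y. 1 / (1 - decay l) * tilt l y) y
        \<le> 1 / (1 - decay l) * tilt l y" for y
    proof -
      have "of_bool (y = 0) \<le> tilt l y"
        using tilt_pos[of l y] by auto
      moreover have "tilt l y + 1 / (1 - decay l) * (decay l * tilt l y) = 1 / (1 - decay l) * tilt l y"
        using d by (simp add: field_simps)
      ultimately show ?thesis
        unfolding walk_mean_cmult walk_mean_tilt by linarith
    qed
  qed
  then show ?thesis
    by (rule le_less_trans) simp
qed

lemma green_all_open: "green l all_open x 0 = ennreal (green0 x)"
  using green_all_open_finite[of x] by (simp add: green0_def)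

lemma green0_nonneg: "green0 x \<ge> 0"
  by (simp add: green0_def)

lemma green0_unfold: "green0 x = of_bool (x = 0) + walk_mean l all_open green0 x"
  unfolding green0_def by (rule green_unfold[OF no_isolated_all_open green_all_open_finite])

lemma walk_mean_green0: "walk_mean l all_open green0 x = green0 x - of_bool (x = 0)"
  using green0_unfold[of x] by simp

lemma green0_0_pos: "green0 0 > 0"
  using green0_unfold[of 0] walk_mean_nonneg[of green0 l all_open 0, OF green0_nonneg] by simp

text \<open>
  Probabilistically, \<open>G(x) / G(0)\<close> is the probability of hitting \<open>0\<close> from \<open>x\<close>, and a superharmonic
  function that is at least \<open>1\<close> at \<open>0\<close> dominates it. The proof avoids hitting times: the
  minimum \<open>w\<close> of \<open>G\<close> and \<open>G(0) k\<close> equals \<open>G\<close> at \<open>0\<close> and satisfies there and elsewhere the inequality of which \<open>G\<close> is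
  the least solution.
\<close>

lemma green0_le:
  assumes nonneg: "\<And>x. k x \<ge> 0" and super: "\<And>x. walk_mean l all_open k x \<le> k x" and "k 0 \<ge> 1"
  shows "green0 x \<le> green0 0 * k x"
proof -
  define w where "w x = min (green0 x) (green0 0 * k x)" for x
  have "green l all_open x 0 \<le> ennreal (w x)"
  proof (rule green_le[OF no_isolated_all_open])
    show "w y \<ge> 0" for y
      by (simp add: w_def green0_nonneg nonneg)
    have le_green0: "of_bool (y = 0) + walk_mean l all_open w y \<le> green0 y" for y
      using walk_mean_mono[of w green0 l all_open y] green0_unfold[of y] by (simp add: w_def)
    show "of_bool (y = 0) + walk_mean l all_open w y \<le> w y" for y
    proof (cases "y = 0")
      case True
      have "w 0 = green0 0"
        using mult_left_mono[OF \<open>k 0 \<ge> 1\<close> green0_nonneg[of 0]] by (simp add: w_def)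
      with le_green0[of 0] True show ?thesis
        by simp
    next
      case False
      have "walk_mean l all_open w y \<le> walk_mean l all_open (\<lambda>y. green0 0 * k y) y"
        by (rule walk_mean_mono) (simp add: w_def)
      also have "\<dots> \<le> green0 0 * k y"
        unfolding walk_mean_cmult by (rule mult_left_mono[OF super green0_nonneg])
      finally show ?thesis
        using le_green0[of y] False by (simp add: w_def)
    qed
  qed
  then have "green0 x \<le> w x"
    by (simp add: green_all_open green0_nonneg nonneg w_def)
  then show ?thesis
    by (simp add: w_def)
qed

lemma green0_le_max: "green0 x \<le> green0 0"
  using green0_le[of "\<lambda>_. 1" x] by (simp add: walk_mean_all_open sum_p0)

lemma green0_le_tilt: "green0 x \<le> green0 0 * tilt l x"
proof (rule green0_le)
  show "walk_mean l all_open (tilt l) y \<le> tilt l y" for y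
    using decay_less_1[OF bias] tilt_pos[of l y] by (simp add: walk_mean_tilt mult_left_le_one_le decay_nonneg)
qed (simp_all add: less_imp_le[OF tilt_pos])

lemma green0_less_max_if_downstream:
  assumes "emb x \<bullet> l > 0"
  shows "green0 x < green0 0"
proof -
  have "green0 0 * tilt l x < green0 0 * 1"
    using assms green0_0_pos by (intro mult_strict_left_mono) (simp_all add: tilt_def)
  with green0_le_tilt[of x] show ?thesis
    by simp
qed

text \<open>
  Away from \<open>0\<close> the value \<open>G(x)\<close> is an average of neighbouring values with positive weights, and none of
  these exceeds \<open>G(0)\<close>.
\<close>

lemma green0_max_propagates:
  assumes "x \<noteq> 0" "green0 x = green0 0" "f \<in> unit_vecs"
  shows "green0 (x + f) = green0 0"
proof -
  have "(\<Sum>e\<in>unit_vecs. p0 l e * (green0 0 - green0 (x + e))) = green0 0 - green0 x"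
    using green0_unfold[of x] \<open>x \<noteq> 0\<close>
    by (simp add: walk_mean_all_open right_diff_distrib sum_subtractf sum_distrib_right[symmetric] sum_p0)
  also have "\<dots> = 0"
    using assms by simp
  finally have "\<forall>e\<in>unit_vecs. p0 l e * (green0 0 - green0 (x + e)) = 0"
    by (subst (asm) sum_nonneg_eq_0_iff) (auto intro!: mult_nonneg_nonneg less_imp_le[OF p0_pos] simp: green0_le_max)
  then show ?thesis
    using assms(3) p0_pos[of f l] by fastforce
qed

lemma green_gap_eq: "green_gap l e = green0 0 - green0 e"
  by (simp add: green_gap_def green0_def)

text \<open>
  If \<open>G(e) = G(0)\<close>, the maximum would propagate to a point \<open>x\<close> with \<open>x \<bullet> l > 0\<close>, where \<open>G\<close> is smaller.
  The path must never leave from \<open>0\<close>, where the mean value equation fails; when \<open>e\<close> points upstream it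
  therefore goes around \<open>0\<close> through \<open>e + f\<close>, \<open>f\<close> and \<open>f - e\<close> with \<open>f\<close> orthogonal to
  \<open>e\<close>.
\<close>

lemma green_gap_pos:
  assumes e: "e \<in> unit_vecs"
  shows "green_gap l e > 0"
proof (rule ccontr)
  assume "\<not> green_gap l e > 0"
  with green0_le_max[of e] have max: "green0 e = green0 0"
    by (simp add: green_gap_eq)
  have e0: "e \<noteq> 0"
    by (rule unit_vec_nonzero[OF e])
  consider "emb e \<bullet> l > 0" | "emb e \<bullet> l = 0" | "emb e \<bullet> l < 0"
    by linarith
  then show False
  proof cases
    case 1
    with max green0_less_max_if_downstream[of e] show False
      by simp
  next
    case 2
    obtain f where f: "f \<in> unit_vecs" "emb f \<bullet> l > 0"
      using unit_vec_direction[OF bias] .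
    with 2 green0_less_max_if_downstream[of "e + f"] green0_max_propagates[OF e0 max f(1)] show False
      by (simp add: inner_add_left)
  next
    case 3
    obtain f where f: "f \<in> unit_vecs" "f \<noteq> e" "f \<noteq> - e" "emb f \<bullet> l \<ge> 0"
      using ex_other_unit_vec[OF dim e] .
    have "e + f \<noteq> 0"
      using f(3) by (auto simp: add_eq_0_iff)
    have "green0 (e + f) = green0 0"
      by (rule green0_max_propagates[OF e0 max f(1)])
    from green0_max_propagates[OF \<open>e + f \<noteq> 0\<close> this, of "- e"] e have "green0 f = green0 0"
      by simp
    from green0_max_propagates[OF unit_vec_nonzero[OF f(1)] this, of "- e"] e have "green0 (f - e) = green0 0"
      by simp
    with 3 f(4) green0_less_max_if_downstream[of "f - e"] show False
      by (simp add: inner_diff_left)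
  qed
qed

text \<open>
  The mean value equation at \<open>0\<close>: one step from \<open>0\<close> loses exactly the visit at time \<open>0\<close>.
\<close>

lemma sum_p0_green_gap: "(\<Sum>e\<in>unit_vecs. p0 l e * green_gap l e) = 1"
  using green0_unfold[of 0]
  by (simp add: green_gap_eq walk_mean_all_open right_diff_distrib sum_subtractf
      sum_distrib_right[symmetric] sum_p0)

text \<open>
  The weights \<open>p(f) J\<^sup>f\<close> are positive and sum to \<open>1\<close> over all directions, and some direction differs
  from \<open>\<plusminus>e\<close>.
\<close>

lemma escape_pos:
  assumes e: "e \<in> unit_vecs"
  shows "1 - p0 l e * green_gap l e - p0 l (- e) * green_gap l (- e) > 0"
proof -
  obtain f where f: "f \<in> unit_vecs" "f \<noteq> e" "f \<noteq> - e"
    using ex_other_unit_vec[OF dim e] .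
  have pos: "p0 l e' * green_gap l e' > 0" if "e' \<in> unit_vecs" for e'
    using that by (simp add: p0_pos green_gap_pos)
  have "(\<Sum>e'\<in>{e, - e, f}. p0 l e' * green_gap l e') \<le> (\<Sum>e'\<in>unit_vecs. p0 l e' * green_gap l e')"
    using e f(1) by (intro sum_mono2) (auto intro: less_imp_le[OF pos])
  then show ?thesis
    using pos[OF f(1)] f unit_vec_neq_uminus[OF e] by (auto simp: sum_p0_green_gap)
qed

section \<open>The Green function with one edge closed\<close>

lemma walk_mean_green0_shift: "walk_mean l all_open (\<lambda>x. green0 (x - e)) x = green0 (x - e) - of_bool (x = e)"
  using walk_mean_green0[of "x - e"] by (simp add: walk_mean_all_open algebra_simps)

text \<open>
  The translate \<open>G(x - e)\<close> solves the mean value equation with source at \<open>e\<close>, so the open walk sees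
  the sources \<open>a\<close> at \<open>0\<close> and \<open>b\<close> at \<open>e\<close>. Closing the edge changes these two values by an amount
  proportional to the difference of \<open>f\<close> across the edge.
\<close>

lemma walk_mean_green_combination:
  fixes a b :: real
  assumes e: "e \<in> unit_vecs"
  defines "f \<equiv> \<lambda>x. a * green0 x + b * green0 (x - e)"
  shows "walk_mean l (one_closed e) f x = f x
    - of_bool (x = 0) * ((a - p0 l e * (f 0 - f e)) / (1 - p0 l e))
    - of_bool (x = e) * ((b + p0 l (- e) * (f 0 - f e)) / (1 - p0 l (- e)))"
proof -
  have all: "walk_mean l all_open f x = f x - a * of_bool (x = 0) - b * of_bool (x = e)" for x
    unfolding f_def walk_mean_add walk_mean_cmult walk_mean_green0 walk_mean_green0_shift
    by (simp add: algebra_simps)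
  have p: "1 - p0 l e > 0" "1 - p0 l (- e) > 0"
    using e by (simp_all add: p0_less_1)
  have alg: "(s - c - q * t) / (1 - q) = s - (c - q * (s - t)) / (1 - q)" if "1 - q > 0" for s t c q :: real
    using that by (simp add: field_simps)
  show ?thesis
    unfolding walk_mean_one_closed[OF e] all
    using unit_vec_nonzero[OF e] alg[OF p(1), of "f 0" a "f e"] alg[OF p(2), of "f e" b "f 0"]
    by (auto simp: algebra_simps)
qed

text \<open>
  The coefficients make the barrier take equal values at \<open>0\<close> and \<open>e\<close>. No mass is then exchanged across
  \<open>[0, e]\<close>, and closing that edge keeps both sources positive.
\<close>

definition barrier :: "int ^ 'n \<Rightarrow> int ^ 'n \<Rightarrow> real" where
  "barrier e x = green_gap l (- e) * green0 x + green_gap l e * green0 (x - e)"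

lemma barrier_nonneg: "e \<in> unit_vecs \<Longrightarrow> barrier e x \<ge> 0"
  unfolding barrier_def
  by (intro add_nonneg_nonneg mult_nonneg_nonneg green0_nonneg less_imp_le green_gap_pos) simp_all

lemma walk_mean_barrier:
  assumes e: "e \<in> unit_vecs"
  shows "walk_mean l (one_closed e) (barrier e) x = barrier e x
    - of_bool (x = 0) * (green_gap l (- e) / (1 - p0 l e))
    - of_bool (x = e) * (green_gap l e / (1 - p0 l (- e)))"
proof -
  have "barrier e 0 - barrier e e = 0"
    by (simp add: barrier_def green_gap_eq algebra_simps)
  then show ?thesis
    using walk_mean_green_combination[OF e, of "green_gap l (- e)" "green_gap l e" x]
    by (simp add: barrier_def[abs_def])
qed

lemma green_one_closed_le:
  assumes e: "e \<in> unit_vecs"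
  shows "green l (one_closed e) x 0 \<le> ennreal ((1 - p0 l e) / green_gap l (- e) * barrier e x)"
proof (rule green_le)
  have p: "1 - p0 l e > 0" "1 - p0 l (- e) > 0" and J: "green_gap l e > 0" "green_gap l (- e) > 0"
    using e by (simp_all add: p0_less_1 green_gap_pos)
  show "no_isolated (one_closed e)"
    by (simp add: e)
  show "0 \<le> (1 - p0 l e) / green_gap l (- e) * barrier e y" for y
    using p J barrier_nonneg[OF e, of y] by simp
  show "of_bool (y = 0) + walk_mean l (one_closed e) (\<lambda>y. (1 - p0 l e) / green_gap l (- e) * barrier e y) y
      \<le> (1 - p0 l e) / green_gap l (- e) * barrier e y" for y
    unfolding walk_mean_cmult walk_mean_barrier[OF e]
    using p J by (simp add: right_diff_distrib)
qed

lemma green_one_closed_finite: "e \<in> unit_vecs \<Longrightarrow> green l (one_closed e) x 0 < \<infinity>"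
  by (rule le_less_trans[OF green_one_closed_le]) simp_all

lemma green0_combination_le_tilt:
  obtains B where "B \<ge> 0" "\<And>x. \<bar>a * green0 x + b * green0 (x - e)\<bar> \<le> B * tilt l x"
proof
  let ?B = "green0 0 * (\<bar>a\<bar> + \<bar>b\<bar> * tilt l (- e))"
  show "?B \<ge> 0"
    using tilt_pos[of l "- e"] by (simp add: green0_nonneg)
  fix x
  have "\<bar>a * green0 x + b * green0 (x - e)\<bar> \<le> \<bar>a\<bar> * green0 x + \<bar>b\<bar> * green0 (x - e)"
    using abs_triangle_ineq[of "a * green0 x" "b * green0 (x - e)"] by (simp add: abs_mult green0_nonneg)
  also have "\<dots> \<le> \<bar>a\<bar> * (green0 0 * tilt l x) + \<bar>b\<bar> * (green0 0 * tilt l (x - e))"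
    by (intro add_mono mult_left_mono green0_le_tilt) simp_all
  also have "\<dots> = ?B * tilt l x"
    using tilt_add[of l x "- e"] by (simp add: algebra_simps)
  finally show "\<bar>a * green0 x + b * green0 (x - e)\<bar> \<le> ?B * tilt l x" .
qed

text \<open>
  The tilt is still contracted by the walk with \<open>[0, e]\<close> closed except at \<open>0\<close> and \<open>e\<close>, and the excess at
  these two points is compensated by a multiple of the barrier. The result bounds the potential of the
  tilt for this walk.
\<close>

lemma tilt_dominated:
  assumes e: "e \<in> unit_vecs"
  obtains W where "\<And>x. W x \<ge> 0" "\<And>x. tilt l x + walk_mean l (one_closed e) W x \<le> W x"
proof -
  let ?T = "walk_mean l (one_closed e)"
  have p: "1 - p0 l e > 0" "1 - p0 l (- e) > 0" and J: "green_gap l e > 0" "green_gap l (- e) > 0"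
    using e by (simp_all add: p0_less_1 green_gap_pos)
  have d: "1 - decay l > 0" "decay l \<ge> 0"
    using decay_less_1[OF bias] decay_nonneg[of l] by simp_all
  define \<alpha> where "\<alpha> = ?T (tilt l) 0"
  define \<beta> where "\<beta> = ?T (tilt l) e"
  have nonneg: "\<alpha> \<ge> 0" "\<beta> \<ge> 0"
    unfolding \<alpha>_def \<beta>_def by (intro walk_mean_nonneg less_imp_le tilt_pos)+
  (* The barrier releases green_gap l (- e) / (1 - p0 l e) at 0 and green_gap l e / (1 - p0 l (- e))
     at e; the multiple c pays for the excess at both points at once. *)
  define c where "c = \<alpha> * ((1 - p0 l e) / green_gap l (- e)) + \<beta> * ((1 - p0 l (- e)) / green_gap l e)"
  have c: "c \<ge> 0" "\<alpha> \<le> c * (green_gap l (- e) / (1 - p0 l e))" "\<beta> \<le> c * (green_gap l e / (1 - p0 l (- e)))"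
    using p J nonneg mult_right_mono[of "\<alpha> * ((1 - p0 l e) / green_gap l (- e))" c "green_gap l (- e) / (1 - p0 l e)"]
      mult_right_mono[of "\<beta> * ((1 - p0 l (- e)) / green_gap l e)" c "green_gap l e / (1 - p0 l (- e))"]
    by (simp_all add: c_def)
  define W where "W x = 1 / (1 - decay l) * (tilt l x + c * barrier e x)" for x
  show thesis
  proof (rule that[of W])
    show "W x \<ge> 0" for x
      using d c tilt_pos[of l x] barrier_nonneg[OF e, of x] by (simp add: W_def)
    fix x
    have "?T (tilt l) x \<le> decay l * tilt l x + of_bool (x = 0) * \<alpha> + of_bool (x = e) * \<beta>"
    proof (cases "x = 0 \<or> x = e")
      case True
      then show ?thesis
        using d tilt_pos[of l x] nonneg unit_vec_nonzero[OF e] by (auto simp: \<alpha>_def \<beta>_def)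
    next
      case False
      then show ?thesis
        by (simp add: walk_mean_one_closed[OF e] walk_mean_tilt)
    qed
    moreover have "c * ?T (barrier e) x \<le> c * barrier e x - of_bool (x = 0) * \<alpha> - of_bool (x = e) * \<beta>"
      using c unit_vec_nonzero[OF e] by (auto simp: walk_mean_barrier[OF e] right_diff_distrib)
    ultimately have "?T (tilt l) x + c * ?T (barrier e) x \<le> decay l * tilt l x + c * barrier e x"
      by linarith
    then have "?T W x \<le> 1 / (1 - decay l) * (decay l * tilt l x + c * barrier e x)"
      unfolding W_def walk_mean_cmult walk_mean_add using d by (intro mult_left_mono) simp_all
    also have "\<dots> = W x - tilt l x"
      using d by (simp add: W_def field_simps)
    finally show "tilt l x + ?T W x \<le> W x"
      by simp
  qed
qed

text \<open>
  Requiring that \<open>a G(x) + b G(x - e)\<close> have source \<open>1\<close> at \<open>0\<close> and none at \<open>e\<close> gives \<open>a = 1 - p(e) + p(e) D\<close> and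
  \<open>b = - p(-e) D\<close>, where \<open>D\<close> is the difference of this function across the edge. Since \<open>D = a J\<^sup>e - b J\<^bsup>-e\<^esup>\<close>,
  this is a linear equation for \<open>D\<close>, whose solution is the right-hand side. The coefficient \<open>b\<close> is negative,
  so minimality of the Green function alone does not identify it; the uniqueness principle does.
\<close>

lemma green_one_closed_gap:
  assumes e: "e \<in> unit_vecs"
  shows "enn2real (green l (one_closed e) 0 0) - enn2real (green l (one_closed e) e 0)
    = (1 - p0 l e) * green_gap l e
      / (1 - p0 l e * green_gap l e - p0 l (- e) * green_gap l (- e))"
proof -
  let ?T = "walk_mean l (one_closed e)"
  have p: "1 - p0 l e > 0" "1 - p0 l (- e) > 0"
    using e by (simp_all add: p0_less_1)
  define G where "G x = enn2real (green l (one_closed e) x 0)" for x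
  have G_nonneg: "G x \<ge> 0" for x
    by (simp add: G_def)
  define D where "D = (1 - p0 l e) * green_gap l e
      / (1 - p0 l e * green_gap l e - p0 l (- e) * green_gap l (- e))"
  define a where "a = 1 - p0 l e + p0 l e * D"
  define b where "b = - p0 l (- e) * D"
  define f where "f x = a * green0 x + b * green0 (x - e)" for x
  have fD: "f 0 - f e = D"
  proof -
    have "f 0 - f e = a * green_gap l e - b * green_gap l (- e)"
      by (simp add: f_def green_gap_eq algebra_simps)
    also have "\<dots> = (1 - p0 l e) * green_gap l e
        + (p0 l e * green_gap l e + p0 l (- e) * green_gap l (- e)) * D"
      by (simp add: a_def b_def algebra_simps)
    also have "(1 - p0 l e) * green_gap l e
        = (1 - p0 l e * green_gap l e - p0 l (- e) * green_gap l (- e)) * D"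
      using escape_pos[OF e] by (simp add: D_def)
    finally show ?thesis
      by (simp add: algebra_simps)
  qed
  have Tf: "?T f x = f x - of_bool (x = 0)" for x
  proof -
    have "(a - p0 l e * D) / (1 - p0 l e) = 1" "b + p0 l (- e) * D = 0"
      using p by (simp_all add: a_def b_def)
    then show ?thesis
      using walk_mean_green_combination[OF e, of a b x] fD by (simp add: f_def[abs_def])
  qed
  have TG: "?T G x = G x - of_bool (x = 0)" for x
    using green_unfold[OF no_isolated_one_closed[OF e] green_one_closed_finite[OF e], of x]
    by (simp add: G_def[abs_def])
  define u where "u x = f x - G x" for x
  obtain B where B: "B \<ge> 0" "\<And>x. \<bar>f x\<bar> \<le> B * tilt l x"
    unfolding f_def using green0_combination_le_tilt by blast
  (* The Green function inherits its decay from the barrier that bounds it. *)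
  obtain B' where B': "B' \<ge> 0" "\<And>x. G x \<le> B' * tilt l x"
  proof -
    obtain B'' where B'': "B'' \<ge> 0" "\<And>x. \<bar>barrier e x\<bar> \<le> B'' * tilt l x"
      unfolding barrier_def using green0_combination_le_tilt by blast
    define c where "c = (1 - p0 l e) / green_gap l (- e)"
    have "c \<ge> 0"
      using p green_gap_pos[of "- e"] e by (simp add: c_def)
    have "G x \<le> (c * B'') * tilt l x" for x
    proof -
      have "ennreal (G x) \<le> ennreal (c * barrier e x)"
        using green_one_closed_le[OF e, of x] green_one_closed_finite[OF e, of x] by (simp add: G_def c_def)
      then have "G x \<le> c * barrier e x"
        using \<open>c \<ge> 0\<close> barrier_nonneg[OF e, of x] by simp
      also have "\<dots> \<le> c * (B'' * tilt l x)"
        using B''(2)[of x] \<open>c \<ge> 0\<close> by (intro mult_left_mono) auto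
      finally show ?thesis
        by (simp add: mult.assoc)
    qed
    with \<open>c \<ge> 0\<close> B''(1) show thesis
      by (intro that[of "c * B''"]) simp_all
  qed
  obtain W where W: "\<And>x. W x \<ge> 0" "\<And>x. tilt l x + ?T W x \<le> W x"
    using tilt_dominated[OF e] by blast
  have u0: "u x = 0" for x
  proof (rule harmonic_zero[OF no_isolated_one_closed[OF e]])
    show "?T u y = u y" for y
      unfolding u_def walk_mean_diff Tf TG by simp
    show "(B + B') * W y \<ge> 0" for y
      using B B' W(1) by simp
    show "\<bar>u y\<bar> + ?T (\<lambda>y. (B + B') * W y) y \<le> (B + B') * W y" for y
    proof -
      have "\<bar>u y\<bar> \<le> (B + B') * tilt l y"
        using B(2)[of y] B'(2)[of y] G_nonneg[of y] unfolding u_def distrib_right by linarith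
      moreover have "(B + B') * tilt l y + (B + B') * ?T W y \<le> (B + B') * W y"
        using mult_left_mono[OF W(2)[of y], of "B + B'"] B(1) B'(1) by (simp add: distrib_left)
      ultimately show ?thesis
        unfolding walk_mean_cmult by linarith
    qed
  qed
  have "G 0 - G e = D"
    using u0[of 0] u0[of e] fD by (simp add: u_def)
  then show ?thesis
    by (simp add: G_def D_def)
qed

end

section \<open>The speed and its first-order coefficient\<close>

lemma emb_inner_unit_vecs:
  assumes "e \<in> unit_vecs" "f \<in> unit_vecs"
  shows "emb e \<bullet> emb f = of_bool (e = f) - of_bool (e = - f)"
  using assms by (auto simp: unit_vecs_iff inner_axis_axis axis_eq_axis uminus_axis axis_eq_0_iff)

lemma v1_inner_unit_vec:
  assumes e: "e \<in> unit_vecs"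
  shows "v1 l \<bullet> emb e = p0 l e - p0 l (- e)"
proof -
  have "v1 l \<bullet> emb e = (\<Sum>f\<in>unit_vecs. p0 l f * of_bool (f = e)) - (\<Sum>f\<in>unit_vecs. p0 l f * of_bool (f = - e))"
    using e by (simp add: v1_def inner_sum_left emb_inner_unit_vecs right_diff_distrib sum_subtractf)
  also have "\<dots> = p0 l e - p0 l (- e)"
    using e by (simp add: of_bool_def if_distrib cong: if_cong)
  finally show ?thesis .
qed

lemma v1_inner_unit_vec_pos_iff:
  assumes e: "e \<in> unit_vecs"
  shows "v1 l \<bullet> emb e > 0 \<longleftrightarrow> emb e \<bullet> l > 0"
  using e partition_sum_pos[of l] by (simp add: v1_inner_unit_vec p0_eq divide_less_cancel)

lemma norm_v1_squared: "(norm (v1 l))\<^sup>2 = (\<Sum>e\<in>unit_vecs. p0 l e * (v1 l \<bullet> emb e))"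
proof -
  have "(norm (v1 l))\<^sup>2 = v1 l \<bullet> (\<Sum>e\<in>unit_vecs. p0 l e *\<^sub>R emb e)"
    by (simp add: power2_norm_eq_inner flip: v1_def)
  then show ?thesis
    by (simp add: inner_sum_right)
qed

text \<open>
  The drift at \<open>0\<close> with \<open>[0, e]\<close> closed is \<open>(v1 - p(e) e) / (1 - p(e))\<close>. The denominator cancels
  against the factor \<open>1 - p(e)\<close> of \<open>green_one_closed_gap\<close> in the formula for \<open>v1'\<close>.
\<close>

lemma v1_minus_drift:
  assumes e: "e \<in> unit_vecs"
  shows "v1 l - drift l e = (p0 l e / (1 - p0 l e)) *\<^sub>R (emb e - v1 l)"
proof -
  have p: "1 - p0 l e > 0"
    using p0_less_1[OF e] by simp
  have "drift l e = (\<Sum>f\<in>unit_vecs. if f = e then 0 else (p0 l f / (1 - p0 l e)) *\<^sub>R emb f)"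
    unfolding drift_def
    by (rule sum.cong) (use trans_prob_one_closed[OF e, of _ l 0] in auto)
  also have "\<dots> = (\<Sum>f\<in>unit_vecs - {e}. (p0 l f / (1 - p0 l e)) *\<^sub>R emb f)"
    by (rule sum.mono_neutral_cong_right) auto
  also have "\<dots> = (1 / (1 - p0 l e)) *\<^sub>R (\<Sum>f\<in>unit_vecs - {e}. p0 l f *\<^sub>R emb f)"
    by (simp add: scaleR_sum_right)
  also have "(\<Sum>f\<in>unit_vecs - {e}. p0 l f *\<^sub>R emb f) = v1 l - p0 l e *\<^sub>R emb e"
    using e by (simp add: v1_def sum_diff1)
  finally have "(1 - p0 l e) *\<^sub>R drift l e = v1 l - p0 l e *\<^sub>R emb e"
    using p by simp
  then have "(1 - p0 l e) *\<^sub>R (v1 l - drift l e) = p0 l e *\<^sub>R (emb e - v1 l)"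
    by (simp add: algebra_simps)
  then have "(1 / (1 - p0 l e)) *\<^sub>R ((1 - p0 l e) *\<^sub>R (v1 l - drift l e))
      = (1 / (1 - p0 l e)) *\<^sub>R (p0 l e *\<^sub>R (emb e - v1 l))"
    by simp
  then show ?thesis
    using p by simp
qed

context biased_walk
begin

definition weight :: "int ^ 'n \<Rightarrow> real" where
  "weight e = p0 l e * green_gap l e / (1 - p0 l e * green_gap l e - p0 l (- e) * green_gap l (- e))"

lemma weight_pos: "e \<in> unit_vecs \<Longrightarrow> weight e > 0"
  unfolding weight_def by (intro divide_pos_pos mult_pos_pos p0_pos green_gap_pos escape_pos)

lemma v1'_eq: "v1' l = (\<Sum>e\<in>unit_vecs. ((v1 l \<bullet> emb e) * weight e) *\<^sub>R (emb e - v1 l))"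
  unfolding v1'_def
proof (rule sum.cong)
  fix e :: "int ^ 'n"
  assume e: "e \<in> unit_vecs"
  have "1 - p0 l e > 0"
    using p0_less_1[OF e] by simp
  then show "((v1 l \<bullet> emb e) * (enn2real (green l (one_closed e) 0 0) - enn2real (green l (one_closed e) e 0)))
        *\<^sub>R (v1 l - drift l e) = ((v1 l \<bullet> emb e) * weight e) *\<^sub>R (emb e - v1 l)"
    unfolding green_one_closed_gap[OF e] v1_minus_drift[OF e] weight_def by simp
qed simp

text \<open>
  Every direction contributes a nonnegative term. Strictness comes from a direction against the
  bias: there \<open>v1 \<bullet> e\<close> and \<open>v1 \<bullet> e - \<bar>v1\<bar>\<^sup>2\<close> are both negative.
\<close>

lemma v1_inner_v1'_pos:
  assumes "speed_condition l"
  shows "v1 l \<bullet> v1' l > 0"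
proof -
  define N where "N = (norm (v1 l))\<^sup>2"
  have expand: "v1 l \<bullet> v1' l = (\<Sum>e\<in>unit_vecs. weight e * ((v1 l \<bullet> emb e) * ((v1 l \<bullet> emb e) - N)))"
    unfolding v1'_eq inner_sum_right
    by (simp add: inner_diff_right N_def power2_norm_eq_inner mult.assoc mult.left_commute)
  obtain f where f: "f \<in> unit_vecs" "emb f \<bullet> l > 0"
    using unit_vec_direction[OF bias] .
  show ?thesis
    unfolding expand
  proof (rule sum_pos2[of _ "- f"])
    have "v1 l \<bullet> emb (- f) < 0"
      using f v1_inner_unit_vec_pos_iff[OF f(1)] by simp
    moreover have "N \<ge> 0"
      by (simp add: N_def)
    ultimately have "(v1 l \<bullet> emb (- f)) * ((v1 l \<bullet> emb (- f)) - N) > 0"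
      by (intro mult_neg_neg) linarith+
    moreover have "weight (- f) > 0"
      using weight_pos[of "- f"] f(1) by simp
    ultimately show "weight (- f) * ((v1 l \<bullet> emb (- f)) * ((v1 l \<bullet> emb (- f)) - N)) > 0"
      by (rule mult_pos_pos[rotated])
  next
    fix e :: "int ^ 'n"
    assume e: "e \<in> unit_vecs"
    have "(v1 l \<bullet> emb e) * ((v1 l \<bullet> emb e) - N) \<ge> 0"
    proof (cases "v1 l \<bullet> emb e > 0")
      case True
      with assms e show ?thesis
        by (intro mult_nonneg_nonneg) (auto simp: speed_condition_def N_def)
    next
      case False
      moreover have "N \<ge> 0"
        by (simp add: N_def)
      ultimately show ?thesis
        by (intro mult_nonpos_nonpos) linarith+
    qed
    then show "weight e * ((v1 l \<bullet> emb e) * ((v1 l \<bullet> emb e) - N)) \<ge> 0"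
      using weight_pos[OF e] by simp
  qed (use f in simp_all)
qed

end

section \<open>When the speed condition holds\<close>

text \<open>
  For a bias along \<open>f\<close> the largest value of \<open>v1 \<bullet> e\<close> is attained at \<open>e = f\<close>, and \<open>\<bar>v1\<bar>\<^sup>2\<close> is an average of
  these values.
\<close>

lemma speed_condition_axis:
  fixes f :: "int ^ 'n"
  assumes f: "f \<in> unit_vecs" and "r > 0"
  shows "speed_condition (r *\<^sub>R emb f)"
  unfolding speed_condition_def
proof (intro ballI impI)
  let ?l = "r *\<^sub>R emb f"
  fix e :: "int ^ 'n"
  assume e: "e \<in> unit_vecs" and pos: "v1 ?l \<bullet> emb e > 0"
  have only: "e' = f" if "e' \<in> unit_vecs" "v1 ?l \<bullet> emb e' > 0" for e'
    using that f \<open>r > 0\<close>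
    by (auto simp: v1_inner_unit_vec_pos_iff emb_inner_unit_vecs zero_less_mult_iff split: if_splits)
  have "(norm (v1 ?l))\<^sup>2 \<le> (\<Sum>e'\<in>unit_vecs. p0 ?l e' * (v1 ?l \<bullet> emb e))"
    unfolding norm_v1_squared
  proof (intro sum_mono mult_left_mono)
    fix e' :: "int ^ 'n"
    assume e': "e' \<in> unit_vecs"
    show "v1 ?l \<bullet> emb e' \<le> v1 ?l \<bullet> emb e"
      using only[OF e'] only[OF e pos] pos by (cases "v1 ?l \<bullet> emb e' > 0") auto
    show "p0 ?l e' \<ge> 0"
      using p0_pos[OF e'] by (rule less_imp_le)
  qed
  then show "v1 ?l \<bullet> emb e \<ge> (norm (v1 ?l))\<^sup>2"
    by (simp add: sum_distrib_right[symmetric] sum_p0)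
qed

text \<open>
  This is \<open>Z\<^sup>2 (v1 \<bullet> e - \<bar>v1\<bar>\<^sup>2)\<close> for \<open>Z = partition_sum l\<close>, written without quotients so that it is easy
  to differentiate along a ray.
\<close>

definition speed_defect :: "real ^ 'n::finite \<Rightarrow> int ^ 'n \<Rightarrow> real" where
  "speed_defect l e = partition_sum l * (exp (emb e \<bullet> l) - exp (- (emb e \<bullet> l)))
     - (\<Sum>f\<in>unit_vecs. exp (2 * (emb f \<bullet> l)) - 1)"

lemma speed_defect_eq:
  fixes l :: "real ^ 'n"
  assumes e: "e \<in> unit_vecs"
  shows "(partition_sum l)\<^sup>2 * (v1 l \<bullet> emb e - (norm (v1 l))\<^sup>2) = speed_defect l e"
proof -
  let ?Z = "partition_sum l"
  have Z: "?Z > 0"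
    by (rule partition_sum_pos)
  have v: "?Z * (v1 l \<bullet> emb f) = exp (emb f \<bullet> l) - exp (- (emb f \<bullet> l))" if "f \<in> unit_vecs" for f
    using that Z by (simp add: v1_inner_unit_vec p0_eq right_diff_distrib)
  have "?Z\<^sup>2 * (norm (v1 l))\<^sup>2 = (\<Sum>f\<in>unit_vecs. exp (2 * (emb f \<bullet> l)) - 1)"
    unfolding norm_v1_squared sum_distrib_left
  proof (rule sum.cong)
    fix f :: "int ^ 'n"
    assume f: "f \<in> unit_vecs"
    have "?Z\<^sup>2 * (p0 l f * (v1 l \<bullet> emb f)) = (?Z * p0 l f) * (?Z * (v1 l \<bullet> emb f))"
      by (simp add: power2_eq_square)
    also have "\<dots> = exp (emb f \<bullet> l) * (exp (emb f \<bullet> l) - exp (- (emb f \<bullet> l)))"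
      unfolding v[OF f] using Z f by (simp add: p0_eq)
    also have "\<dots> = exp (2 * (emb f \<bullet> l)) - 1"
      by (simp add: right_diff_distrib exp_add[symmetric])
    finally show "?Z\<^sup>2 * (p0 l f * (v1 l \<bullet> emb f)) = exp (2 * (emb f \<bullet> l)) - 1" .
  qed simp
  moreover have "?Z\<^sup>2 * (v1 l \<bullet> emb e) = ?Z * (exp (emb e \<bullet> l) - exp (- (emb e \<bullet> l)))"
    unfolding v[OF e, symmetric] by (simp add: power2_eq_square)
  ultimately show ?thesis
    by (simp add: speed_defect_def right_diff_distrib)
qed

text \<open>
  Along the ray \<open>r u\<close> the defect vanishes at \<open>r = 0\<close>. The sum \<open>\<Sum>\<^sub>f exp (2 r (f \<bullet> u)) - 1\<close> has derivative \<open>0\<close> there,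
  because the directions cancel in pairs, and the remaining term has derivative \<open>4 d (e \<bullet> u) > 0\<close>.
\<close>

lemma speed_defect_pos:
  fixes u :: "real ^ 'n"
  assumes "emb e \<bullet> u > 0"
  shows "eventually (\<lambda>r. speed_defect (r *\<^sub>R u) e > 0) (at_right 0)"
proof -
  let ?U = "unit_vecs :: (int ^ 'n) set"
  let ?D = "card ?U * (2 * (emb e \<bullet> u))"
  have exp_deriv: "((\<lambda>r. exp (r * c)) has_real_derivative c) (at 0)" for c :: real
    by (auto intro!: derivative_eq_intros)
  have "((\<lambda>r. (\<Sum>f\<in>?U. exp (r * (emb f \<bullet> u))) * (exp (r * (emb e \<bullet> u)) - exp (r * (- (emb e \<bullet> u))))
        - (\<Sum>f\<in>?U. exp (r * (2 * (emb f \<bullet> u))) - 1)) has_real_derivative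
      (\<Sum>f\<in>?U. emb f \<bullet> u) * (exp (0 * (emb e \<bullet> u)) - exp (0 * (- (emb e \<bullet> u))))
      + ((emb e \<bullet> u) - (- (emb e \<bullet> u))) * (\<Sum>f\<in>?U. exp (0 * (emb f \<bullet> u)))
      - (\<Sum>f\<in>?U. 2 * (emb f \<bullet> u) - 0)) (at 0)"
    by (intro DERIV_diff DERIV_mult DERIV_sum exp_deriv DERIV_const)
  also have "(\<lambda>r. (\<Sum>f\<in>?U. exp (r * (emb f \<bullet> u))) * (exp (r * (emb e \<bullet> u)) - exp (r * (- (emb e \<bullet> u))))
        - (\<Sum>f\<in>?U. exp (r * (2 * (emb f \<bullet> u))) - 1)) = (\<lambda>r. speed_defect (r *\<^sub>R u) e)"
    by (simp add: speed_defect_def partition_sum_def fun_eq_iff mult.left_commute)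
  also have "(\<Sum>f\<in>?U. emb f \<bullet> u) * (exp (0 * (emb e \<bullet> u)) - exp (0 * (- (emb e \<bullet> u))))
      + ((emb e \<bullet> u) - (- (emb e \<bullet> u))) * (\<Sum>f\<in>?U. exp (0 * (emb f \<bullet> u)))
      - (\<Sum>f\<in>?U. 2 * (emb f \<bullet> u) - 0) = ?D"
    by (simp add: sum_distrib_left[symmetric] sum_unit_vecs_inner)
  finally have deriv: "((\<lambda>r. speed_defect (r *\<^sub>R u) e) has_real_derivative ?D) (at 0)" .
  have "?U \<noteq> {}"
    by (auto simp: unit_vecs_def)
  then have "?D > 0"
    using assms by (simp add: card_gt_0_iff)
  from DERIV_pos_inc_right[OF deriv this] show ?thesis
    by (simp add: eventually_at_right_field speed_defect_def)
qed

text \<open>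
  There are finitely many directions, so one threshold serves all of them. It depends on \<open>u\<close>, since
  a direction \<open>e\<close> almost orthogonal to \<open>u\<close> forces a small threshold.
\<close>

lemma speed_condition_small_bias:
  fixes u :: "real ^ 'n"
  shows "\<exists>r\<^sub>c>0. \<forall>r. 0 < r \<and> r < r\<^sub>c \<longrightarrow> speed_condition (r *\<^sub>R u)"
proof -
  have "eventually (\<lambda>r. \<forall>e\<in>{e \<in> unit_vecs. emb e \<bullet> u > 0}. speed_defect (r *\<^sub>R u) e > 0) (at_right 0)"
    by (intro eventually_ball_finite) (auto intro: speed_defect_pos)
  then obtain r\<^sub>c where rc: "r\<^sub>c > 0"
    "\<And>r e. 0 < r \<Longrightarrow> r < r\<^sub>c \<Longrightarrow> e \<in> unit_vecs \<Longrightarrow> emb e \<bullet> u > 0 \<Longrightarrow> speed_defect (r *\<^sub>R u) e > 0"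
    by (auto simp: eventually_at_right_field)
  have "speed_condition (r *\<^sub>R u)" if r: "0 < r" "r < r\<^sub>c" for r
    unfolding speed_condition_def
  proof (intro ballI impI)
    fix e :: "int ^ 'n"
    assume e: "e \<in> unit_vecs" and "v1 (r *\<^sub>R u) \<bullet> emb e > 0"
    then have "emb e \<bullet> u > 0"
      using r by (simp add: v1_inner_unit_vec_pos_iff zero_less_mult_iff)
    from rc(2)[OF r e this] have "v1 (r *\<^sub>R u) \<bullet> emb e - (norm (v1 (r *\<^sub>R u)))\<^sup>2 > 0"
      using partition_sum_pos[of "r *\<^sub>R u"] by (simp add: speed_defect_eq[OF e, symmetric] zero_less_mult_iff)
    then show "v1 (r *\<^sub>R u) \<bullet> emb e \<ge> (norm (v1 (r *\<^sub>R u)))\<^sup>2"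
      by simp
  qed
  with rc(1) show ?thesis
    by blast
qed

theorem proposition2p1:
  assumes "CARD('n::finite) \<ge> 2"
  shows
    "(\<forall>l :: real ^ 'n. l \<noteq> 0 \<longrightarrow>
        (\<forall>e\<in>unit_vecs.
           green l all_open 0 0 < \<infinity> \<and> green l all_open e 0 < \<infinity> \<and>
           green l (one_closed e) 0 0 < \<infinity> \<and> green l (one_closed e) e 0 < \<infinity> \<and>
           1 - p0 l e * green_gap l e - p0 l (-e) * green_gap l (-e) \<noteq> 0) \<and>
        v1' l = (\<Sum>e\<in>unit_vecs.
           ((v1 l \<bullet> emb e) * (p0 l e * green_gap l e / (1 - p0 l e * green_gap l e - p0 l (-e) * green_gap l (-e))))
             *\<^sub>R (emb e - v1 l)) \<and>
        (speed_condition l \<longrightarrow> v1 l \<bullet> v1' l > 0)) \<and>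
     (\<forall>u\<in>emb ` (unit_vecs :: (int ^ 'n) set). \<forall>r>0. speed_condition (r *\<^sub>R u)) \<and>
     (\<forall>u :: real ^ 'n. norm u = 1 \<longrightarrow>
        (\<exists>r\<^sub>c>0. \<forall>r. 0 < r \<and> r < r\<^sub>c \<longrightarrow> speed_condition (r *\<^sub>R u)))"
proof (intro conjI allI impI ballI)
  fix l :: "real ^ 'n"
  assume "l \<noteq> 0"
  then interpret biased_walk l
    using assms by unfold_locales
  show "v1' l = (\<Sum>e\<in>unit_vecs.
           ((v1 l \<bullet> emb e) * (p0 l e * green_gap l e / (1 - p0 l e * green_gap l e - p0 l (-e) * green_gap l (-e))))
             *\<^sub>R (emb e - v1 l))"
    using v1'_eq unfolding weight_def .
  show "v1 l \<bullet> v1' l > 0" if "speed_condition l"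
    using that by (rule v1_inner_v1'_pos)
  fix e :: "int ^ 'n"
  assume e: "e \<in> unit_vecs"
  show "green l all_open 0 0 < \<infinity>" "green l all_open e 0 < \<infinity>"
    by (rule green_all_open_finite)+
  show "green l (one_closed e) 0 0 < \<infinity>" "green l (one_closed e) e 0 < \<infinity>"
    by (rule green_one_closed_finite[OF e])+
  show "1 - p0 l e * green_gap l e - p0 l (- e) * green_gap l (- e) \<noteq> 0"
    using escape_pos[OF e] by simp
next
  fix u :: "real ^ 'n" and r :: real
  assume "u \<in> emb ` unit_vecs" "r > 0"
  then show "speed_condition (r *\<^sub>R u)"
    using speed_condition_axis by blast
next
  fix u :: "real ^ 'n"
  show "\<exists>r\<^sub>c>0. \<forall>r. 0 < r \<and> r < r\<^sub>c \<longrightarrow> speed_condition (r *\<^sub>R u)"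
    by (rule speed_condition_small_bias)
qed

end
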